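(* Fix $\varepsilon\le 1/6$ and let $n,m,\alpha$ be parameters with $\alpha=\alpha(n)\le\sqrt{m}$ and $m\le n\alpha$. Let $\mathcal{G}^\alpha_{n,m}$ be the family of graphs with $n$ vertices, $m$ edges and arboricity at most $\alpha$. Then any algorithm $\mathcal{A}$ that, for every $G\in\mathcal{G}^\alpha_{n,m}$, samples edges of $G$ from a distribution that is $\varepsilon$-close to uniform (over the edge set of $G$) in total variation distance — and in particular any such algorithm sampling from a distribution that is pointwise $\varepsilon$-close to uniform — requires $\Omega(\alpha/d)$ queries in expectation, where $d=2m/n$.
   Context: Queries are in the uniform vertex sampling model: vertex set $\{1,\dots,n\}$, uniform vertex samples, degree queries $\deg(v)$ returning $d(v)$, and neighbor queries $\mathrm{nbr}(v,i)$ returning the $i$-th neighbor of $v$ (arbitrary fixed order) or $\bot$ if $i>d(v)$. The arboricity of a graph is the minimum number of spanning forests whose edge sets cover the edge set. A distribution $\widehat{D}$ is pointwise $\varepsilon$-close to uniform $U$ on $X$ if $|\widehat{D}(x)-U(x)|\le\varepsilon U(x)$ for all $x\in X$.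
   Formalization: The bound Ω(α/d) is proved for nonempty families once α/d exceeds an absolute constant; for bounded α/d it can fail (if the family is only K_n, with m=n(n-1)/2 and α=n/2, a random pair is a uniform edge with 0 queries). *)

theory Defs
  imports "HOL-Probability.Probability"
begin

section \<open>Simple graphs and arboricity\<close>

text \<open>A simple graph on the vertex set \<open>{1..n}\<close> is given by its set of edges,
  which are two-element sets of vertices.\<close>

type_synonym edge = "nat set"

definition simple_graph :: "nat \<Rightarrow> edge set \<Rightarrow> bool" where
  "simple_graph n E \<longleftrightarrow> E \<subseteq> {{u, v} | u v. u \<in> {1..n} \<and> v \<in> {1..n} \<and> u \<noteq> v}"

definition neighbors :: "edge set \<Rightarrow> nat \<Rightarrow> nat set" where
  "neighbors E v = {w. {v, w} \<in> E}"

definition degree :: "edge set \<Rightarrow> nat \<Rightarrow> nat" where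
  "degree E v = card (neighbors E v)"

definition is_cycle :: "edge set \<Rightarrow> nat list \<Rightarrow> bool" where
  "is_cycle E xs \<longleftrightarrow> length xs \<ge> 3 \<and> distinct xs \<and>
     (\<forall>i < length xs. {xs ! i, xs ! (Suc i mod length xs)} \<in> E)"

definition is_forest :: "edge set \<Rightarrow> bool" where
  "is_forest F \<longleftrightarrow> (\<nexists>xs. is_cycle F xs)"

text \<open>A spanning forest has all of \<open>{1..n}\<close> as vertices, so it is determined by its edges.\<close>

definition arboricity :: "edge set \<Rightarrow> nat" where
  "arboricity E = (LEAST k. \<exists>F :: nat \<Rightarrow> edge set.
     (\<forall>i<k. F i \<subseteq> E \<and> is_forest (F i)) \<and> E \<subseteq> (\<Union>i<k. F i))"

definition graph_family :: "nat \<Rightarrow> nat \<Rightarrow> real \<Rightarrow> edge set set" where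
  "graph_family n m \<alpha> = {E. simple_graph n E \<and> card E = m \<and> real (arboricity E) \<le> \<alpha>}"

section \<open>The uniform vertex sampling query model\<close>

text \<open>The order in which neighbor queries enumerate the neighbors of each vertex.\<close>

definition neighbor_order :: "nat \<Rightarrow> edge set \<Rightarrow> (nat \<Rightarrow> nat list) \<Rightarrow> bool" where
  "neighbor_order n E L \<longleftrightarrow> (\<forall>v\<in>{1..n}. distinct (L v) \<and> set (L v) = neighbors E v)"

datatype query = Sample | Deg nat | Nbr nat nat

datatype answer = Vertex nat | Degree nat | Neighbor "nat option"

text \<open>Neighbor indices start at 1; \<open>None\<close> stands for the symbol \<open>\<bottom>\<close>.\<close>

fun answer_query :: "nat \<Rightarrow> edge set \<Rightarrow> (nat \<Rightarrow> nat list) \<Rightarrow> query \<Rightarrow> answer pmf" where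
  "answer_query n E L Sample = map_pmf Vertex (pmf_of_set {1..n})"
| "answer_query n E L (Deg v) = return_pmf (Degree (degree E v))"
| "answer_query n E L (Nbr v i) = return_pmf (Neighbor
     (if 1 \<le> i \<and> i \<le> degree E v then Some (L v ! (i - 1)) else None))"

text \<open>A randomized, adaptive algorithm chooses its next action at random, depending on the
  transcript of all previous queries and answers. It need not have a bound on the number of
  queries, and it may output any set of numbers, which includes sets that are not edges.\<close>

datatype action = Ask query | Output edge

type_synonym transcript = "(query \<times> answer) list"

type_synonym algorithm = "transcript \<Rightarrow> action pmf"

text \<open>A state is the transcript together with the output, if it has been produced.\<close>

fun step :: "nat \<Rightarrow> edge set \<Rightarrow> (nat \<Rightarrow> nat list) \<Rightarrow> algorithm \<Rightarrow>
    transcript \<times> edge option \<Rightarrow> (transcript \<times> edge option) pmf" where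
  "step n E L A (h, Some e) = return_pmf (h, Some e)"
| "step n E L A (h, None) = bind_pmf (A h) (\<lambda>a. case a of
       Output e \<Rightarrow> return_pmf (h, Some e)
     | Ask q \<Rightarrow> map_pmf (\<lambda>r. (h @ [(q, r)], None)) (answer_query n E L q))"

fun run :: "nat \<Rightarrow> edge set \<Rightarrow> (nat \<Rightarrow> nat list) \<Rightarrow> algorithm \<Rightarrow> nat \<Rightarrow>
    (transcript \<times> edge option) pmf" where
  "run n E L A 0 = return_pmf ([], None)"
| "run n E L A (Suc k) = bind_pmf (run n E L A k) (step n E L A)"

text \<open>The probability of having output \<open>e\<close> within \<open>k\<close> steps increases with \<open>k\<close>. As \<open>D\<close> has
  total mass 1, \<open>samples_from\<close> implies that the algorithm terminates with probability 1.\<close>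

definition samples_from :: "nat \<Rightarrow> edge set \<Rightarrow> (nat \<Rightarrow> nat list) \<Rightarrow> algorithm \<Rightarrow>
    edge pmf \<Rightarrow> bool" where
  "samples_from n E L A D \<longleftrightarrow>
     (\<forall>e. (\<lambda>k. measure_pmf.prob (run n E L A k) {s. snd s = Some e}) \<longlonglongrightarrow> pmf D e)"

text \<open>The length of the transcript is nondecreasing along a run, so by monotone convergence the
  supremum is the expectation of the total number of queries (samples included).\<close>

definition expected_queries :: "nat \<Rightarrow> edge set \<Rightarrow> (nat \<Rightarrow> nat list) \<Rightarrow> algorithm \<Rightarrow> ennreal"
  where
  "expected_queries n E L A =
     (SUP k. \<integral>\<^sup>+ s. of_nat (length (fst s)) \<partial>measure_pmf (run n E L A k))"

section \<open>Closeness to the uniform distribution\<close>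

definition tv_dist :: "'a pmf \<Rightarrow> 'a pmf \<Rightarrow> real" where
  "tv_dist P Q = (SUP S. \<bar>measure_pmf.prob P S - measure_pmf.prob Q S\<bar>)"

definition tv_close_to_uniform :: "real \<Rightarrow> 'a pmf \<Rightarrow> 'a set \<Rightarrow> bool" where
  "tv_close_to_uniform \<epsilon> D X \<longleftrightarrow> tv_dist D (pmf_of_set X) \<le> \<epsilon>"

definition pointwise_close_to_uniform :: "real \<Rightarrow> 'a pmf \<Rightarrow> 'a set \<Rightarrow> bool" where
  "pointwise_close_to_uniform \<epsilon> D X \<longleftrightarrow>
     (\<forall>x\<in>X. \<bar>pmf D x - pmf (pmf_of_set X) x\<bar> \<le> \<epsilon> * pmf (pmf_of_set X) x)"

end

theory Submission
  imports Defs
begin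

text \<open>
  Cut the vertices into \<open>N = \<Omega>(\<alpha>/d)\<close> disjoint blocks of size \<open>h = O(m/\<alpha>)\<close>. The graph
  \<open>E\<^sub>b\<close> has all its \<open>m\<close> edges inside block \<open>b\<close>, where they form \<open>\<lfloor>\<alpha>\<rfloor>\<close> stars, and all other
  vertices are isolated. As long as the algorithm asks no degree or neighbor query in block \<open>b\<close>,
  its transcript on \<open>E\<^sub>b\<close> has the same law as on the empty graph. On the empty graph, \<open>T\<close> steps
  touch at most \<open>T\<close> blocks and the output is an edge of at most one \<open>E\<^sub>b\<close>. So on average over \<open>b\<close>
  the probability of finding an edge of \<open>E\<^sub>b\<close> within \<open>T\<close> steps is at most \<open>(T + 1)/N\<close>, while
  closeness to uniform and Markov's inequality force it to be bounded below once \<open>T\<close> is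
  twice the expected number of queries.
\<close>

section \<open>Unions of stars\<close>

text \<open>Edges 0 and 1 of a cycle meet only in \<open>xs ! 1\<close>, so this vertex must be
  \<open>c\<close>; but the edge leaving \<open>xs ! 2\<close> misses it.\<close>

lemma is_forest_star:
  assumes "\<And>e. e \<in> F \<Longrightarrow> c \<in> e"
  shows "is_forest F"
  unfolding is_forest_def
proof
  assume "\<exists>xs. is_cycle F xs"
  then obtain xs where l: "length xs \<ge> 3" and d: "distinct xs"
    and e: "\<And>i. i < length xs \<Longrightarrow> {xs ! i, xs ! (Suc i mod length xs)} \<in> F"
    unfolding is_cycle_def by blast
  have neq: "xs ! i \<noteq> xs ! j" if "i < length xs" "j < length xs" "i \<noteq> j" for i j
    using d that by (simp add: nth_eq_iff_index_eq)
  have "0 < length xs" "1 < length xs" "1 mod length xs = 1" "2 mod length xs = 2"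
    using l by auto
  then have "c \<in> {xs ! 0, xs ! 1}" "c \<in> {xs ! 1, xs ! 2}"
    using assms[OF e[of 0]] assms[OF e[of 1]] by (simp_all add: numeral_2_eq_2)
  moreover have "xs ! 0 \<noteq> xs ! 2"
    using l by (intro neq) auto
  ultimately have c: "c = xs ! 1"
    by auto
  \<comment> \<open>In a triangle this index wraps around to 0, in longer cycles it is 3.\<close>
  have "3 mod length xs \<noteq> 1" "3 mod length xs < length xs"
    using l by (cases "length xs = 3"; simp)+
  then have "xs ! 1 \<noteq> xs ! (3 mod length xs)" "xs ! 1 \<noteq> xs ! 2"
    using l neq[of 1 "3 mod length xs"] neq[of 1 2] by auto
  moreover have "c \<in> {xs ! 2, xs ! (3 mod length xs)}"
    using assms[OF e[of 2]] l by (simp add: numeral_3_eq_3 numeral_2_eq_2)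
  ultimately show False
    using c by auto
qed

lemma arboricity_le:
  assumes "\<And>i. i < k \<Longrightarrow> F i \<subseteq> E \<and> is_forest (F i)" "E \<subseteq> (\<Union>i<k. F i)"
  shows "arboricity E \<le> k"
  unfolding arboricity_def using assms by (intro Least_le) blast

text \<open>Single edges are forests, so a cover exists and the \<open>LEAST\<close> is attained;
  zero forests cover no edge. This later forces \<alpha> \<ge> 1.\<close>

lemma arboricity_pos:
  assumes "simple_graph n E" "finite E" "E \<noteq> {}"
  shows "arboricity E \<ge> 1"
proof -
  let ?P = "\<lambda>k. \<exists>F :: nat \<Rightarrow> edge set.
    (\<forall>i<k. F i \<subseteq> E \<and> is_forest (F i)) \<and> E \<subseteq> (\<Union>i<k. F i)"
  obtain f where f: "bij_betw f {0..<card E} E"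
    using ex_bij_betw_nat_finite[OF assms(2)] by blast
  have "?P (card E)"
  proof (intro exI conjI allI impI)
    fix i assume "i < card E"
    then have "f i \<in> E"
      using f by (auto simp: bij_betw_def)
    then show "{f i} \<subseteq> E"
      by simp
    from \<open>f i \<in> E\<close> obtain c where "c \<in> f i"
      using assms(1) unfolding simple_graph_def by blast
    then show "is_forest {f i}"
      by (intro is_forest_star[of _ c]) auto
  next
    show "E \<subseteq> (\<Union>i<card E. {f i})"
      using f by (auto simp: bij_betw_def atLeast0LessThan)
  qed
  then have "?P (arboricity E)"
    unfolding arboricity_def by (rule LeastI)
  with assms(3) show ?thesis
    by (cases "arboricity E") auto
qed

text \<open>\<open>m\<close> edges shared evenly among \<open>a\<close> stars with centers \<open>o' + 1, \<dots>, o' + a\<close>.\<close>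

definition star_edge :: "nat \<Rightarrow> nat \<Rightarrow> nat \<Rightarrow> edge" where
  "star_edge a o' t = {o' + 1 + t mod a, o' + 1 + a + t div a}"

definition stars :: "nat \<Rightarrow> nat \<Rightarrow> nat \<Rightarrow> edge set" where
  "stars a m o' = star_edge a o' ` {..<m}"

text \<open>All centers precede all leaves, so equal edges agree in center and in leaf, that is, in
  remainder and quotient of \<open>t\<close>.\<close>

lemma inj_star_edge:
  assumes "a > 0"
  shows "inj (star_edge a o')"
proof (rule injI)
  fix s t assume eq: "star_edge a o' s = star_edge a o' t"
  have "s mod a < a" "t mod a < a"
    using assms by simp_all
  then have "s mod a = t mod a" "s div a = t div a"
    using eq by (auto simp: star_edge_def doubleton_eq_iff)
  then show "s = t"
    by (metis div_mult_mod_eq)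
qed

lemma card_stars: "a > 0 \<Longrightarrow> card (stars a m o') = m"
  unfolding stars_def by (simp add: card_image inj_on_subset[OF inj_star_edge])

text \<open>The stars share their leaves: the graph is complete bipartite except perhaps at the last
  leaf, so at most \<open>1 + (m - 1) div a\<close> leaves occur. This keeps the blocks
  small.\<close>

lemma stars_range:
  assumes "a > 0" "e \<in> stars a m o'"
  shows "e \<subseteq> {o' + 1..o' + (a + 1 + (m - 1) div a)}"
proof -
  obtain t where t: "t < m" "e = star_edge a o' t"
    using assms(2) by (auto simp: stars_def)
  have "t mod a < a"
    using assms(1) by simp
  moreover have "t div a \<le> (m - 1) div a"
    using t(1) by (intro div_le_mono) simp
  ultimately show ?thesis
    by (auto simp: t(2) star_edge_def)
qed

lemma simple_graph_stars:
  assumes "a > 0" "o' + (a + 1 + (m - 1) div a) \<le> n"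
  shows "simple_graph n (stars a m o')"
  unfolding simple_graph_def
proof
  fix e assume e: "e \<in> stars a m o'"
  then obtain t where t: "e = star_edge a o' t"
    by (auto simp: stars_def)
  have "t mod a < a"
    using assms(1) by simp
  then show "e \<in> {{u, v} | u v. u \<in> {1..n} \<and> v \<in> {1..n} \<and> u \<noteq> v}"
    using stars_range[OF assms(1) e] assms(2) unfolding t star_edge_def
    by (intro CollectI exI[of _ "o' + 1 + t mod a"] exI[of _ "o' + 1 + a + t div a"]) auto
qed

lemma arboricity_stars:
  assumes "a > 0"
  shows "arboricity (stars a m o') \<le> a"
\<comment> \<open>A residue class modulo \<open>a\<close> collects the edges at one center.\<close>
proof (rule arboricity_le[where F = "\<lambda>i. star_edge a o' ` {t. t < m \<and> t mod a = i}"], intro conjI)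
  fix i
  show "star_edge a o' ` {t. t < m \<and> t mod a = i} \<subseteq> stars a m o'"
    by (auto simp: stars_def)
  show "is_forest (star_edge a o' ` {t. t < m \<and> t mod a = i})"
    by (rule is_forest_star[of _ "o' + 1 + i"]) (auto simp: star_edge_def)
next
  show "stars a m o' \<subseteq> (\<Union>i<a. star_edge a o' ` {t. t < m \<and> t mod a = i})"
    using assms by (auto simp: stars_def intro!: bexI[of _ "_ mod a"])
qed

section \<open>Runs of the algorithm\<close>

fun queried_by :: "query \<Rightarrow> nat set" where
  "queried_by Sample = {}"
| "queried_by (Deg v) = {v}"
| "queried_by (Nbr v i) = {v}"

text \<open>Samples contribute nothing, because for fixed \<open>n\<close> their answers have the
  same law on every graph.\<close>

definition queried :: "transcript \<Rightarrow> nat set" where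
  "queried h = (\<Union>(q, r)\<in>set h. queried_by q)"

lemma queried_append: "queried (h @ h') = queried h \<union> queried h'"
  by (auto simp: queried_def)

lemma finite_queried_by: "finite (queried_by q)" "card (queried_by q) \<le> 1"
  by (cases q; simp)+

lemma finite_queried: "finite (queried h)" "card (queried h) \<le> length h"
proof (induction h)
  case (Cons x h)
  obtain q r where x: "x = (q, r)"
    by (cases x)
  have eq: "queried (x # h) = queried_by q \<union> queried h"
    by (auto simp: x queried_def)
  { case 1 show ?case
      using Cons finite_queried_by by (simp add: eq) }
  { case 2 show ?case
      using Cons finite_queried_by(2)[of q] card_Un_le[of "queried_by q" "queried h"]
      by (simp add: eq) }
qed (simp_all add: queried_def)

text \<open>An isolated vertex has degree 0, so every neighbor query at it returns
  \<open>None\<close> and the neighbor lists are never consulted.\<close>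

lemma answer_query_isolated:
  assumes "\<And>v. v \<in> queried_by q \<Longrightarrow> neighbors E v = {}"
  shows "answer_query n E L q = answer_query n {} L' q"
  using assms by (cases q) (simp_all add: degree_def neighbors_def)

lemma step_cases:
  assumes "s \<in> set_pmf (step n E L A (h, o'))"
  obtains (halted) "o' \<noteq> None" "s = (h, o')"
    | (finish) e where "o' = None" "s = (h, Some e)"
    | (ask) q r where "o' = None" "s = (h @ [(q, r)], None)"
proof (cases o')
  case None
  then obtain x where "s \<in> set_pmf (case x of Output e \<Rightarrow> return_pmf (h, Some e)
      | Ask q \<Rightarrow> map_pmf (\<lambda>r. (h @ [(q, r)], None)) (answer_query n E L q))"
    using assms by auto
  then show ?thesis
    using None finish ask by (cases x) auto
qed (use assms halted in auto)

text \<open>A query that leads to \<open>h'\<close> is recorded in \<open>h'\<close>, so it touches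
  isolated vertices only; any other query gives \<open>h'\<close> probability 0 on both
  graphs.\<close>

lemma pmf_step_isolated:
  assumes "\<And>v. v \<in> queried h' \<Longrightarrow> neighbors E v = {}"
  shows "pmf (step n E L A s) (h', r) = pmf (step n {} L' A s) (h', r)"
proof (cases s)
  case (Pair h o')
  show ?thesis
  proof (cases o')
    case None
    have "pmf (case a of Output e \<Rightarrow> return_pmf (h, Some e)
           | Ask q \<Rightarrow> map_pmf (\<lambda>r. (h @ [(q, r)], None)) (answer_query n E L q)) (h', r) =
          pmf (case a of Output e \<Rightarrow> return_pmf (h, Some e)
           | Ask q \<Rightarrow> map_pmf (\<lambda>r. (h @ [(q, r)], None)) (answer_query n {} L' q)) (h', r)" for a
    proof (cases a)
      case (Ask q)
      show ?thesis
      proof (cases "\<exists>z. h' = h @ [(q, z)]")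
        case True
        then have "queried_by q \<subseteq> queried h'"
          by (auto simp: queried_def)
        then have "answer_query n E L q = answer_query n {} L' q"
          using assms by (intro answer_query_isolated) blast
        then show ?thesis
          by (simp add: Ask)
      next
        case False
        then have "pmf (map_pmf (\<lambda>r. (h @ [(q, r)], None)) p) (h', r) = 0" for p
          by (auto simp: pmf_eq_0_set_pmf)
        then show ?thesis
          by (simp add: Ask)
      qed
    qed simp
    then show ?thesis
      by (simp add: Pair None pmf_bind)
  qed (simp add: Pair)
qed

text \<open>Transcripts only grow, so a state that can reach \<open>(h, r)\<close> in one step has a
  prefix of \<open>h\<close> as transcript and inherits the hypothesis. All other states contribute
  0.\<close>

lemma pmf_run_isolated:
  assumes "\<And>v. v \<in> queried h \<Longrightarrow> neighbors E v = {}"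
  shows "pmf (run n E L A k) (h, r) = pmf (run n {} L' A k) (h, r)"
  using assms
proof (induction k arbitrary: h r)
  case (Suc k)
  have step_eq: "pmf (step n E L A s) (h, r) = pmf (step n {} L' A s) (h, r)" for s
    by (rule pmf_step_isolated) (rule Suc.prems)
  have "ennreal (pmf (run n E L A k) s) * ennreal (pmf (step n E L A s) (h, r)) =
        ennreal (pmf (run n {} L' A k) s) * ennreal (pmf (step n {} L' A s) (h, r))" for s
  proof (cases "pmf (step n E L A s) (h, r) = 0")
    case True
    then show ?thesis
      using step_eq[of s] by simp
  next
    case False
    obtain h0 r0 where s: "s = (h0, r0)"
      by (cases s)
    from False have "(h, r) \<in> set_pmf (step n E L A (h0, r0))"
      by (simp add: s pmf_eq_0_set_pmf)
    then obtain z where "h = h0 @ z"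
      by (cases rule: step_cases) auto
    then have "pmf (run n E L A k) s = pmf (run n {} L' A k) s"
      using Suc.prems unfolding s by (intro Suc.IH) (auto simp: queried_append)
    then show ?thesis
      using step_eq[of s] by simp
  qed
  then have "ennreal (pmf (run n E L A (Suc k)) (h, r)) = ennreal (pmf (run n {} L' A (Suc k)) (h, r))"
    by (simp add: ennreal_pmf_bind nn_integral_measure_pmf)
  then show ?case
    by simp
qed simp

lemma length_run:
  assumes "s \<in> set_pmf (run n E L A k)"
  shows "length (fst s) \<le> k \<and> (snd s = None \<longrightarrow> length (fst s) = k)"
  using assms
proof (induction k arbitrary: s)
  case (Suc k)
  then obtain s0 where s0: "s0 \<in> set_pmf (run n E L A k)" "s \<in> set_pmf (step n E L A s0)"
    by auto
  obtain h o' where "s0 = (h, o')"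
    by (cases s0)
  with s0(2) have "s \<in> set_pmf (step n E L A (h, o'))"
    by simp
  then show ?case
    using Suc.IH[OF s0(1)] \<open>s0 = (h, o')\<close> by (cases rule: step_cases) auto
qed simp

text \<open>Markov's inequality: by \<open>length_run\<close> an unfinished run has asked exactly
  \<open>T\<close> queries.\<close>

lemma prob_not_output_le:
  assumes "expected_queries n E L A \<le> ennreal Q" "0 < T" "0 \<le> Q"
  shows "measure_pmf.prob (run n E L A T) {s. snd s = None} \<le> Q / real T"
proof -
  let ?p = "run n E L A T"
  have "ennreal (real T * measure_pmf.prob ?p {s. snd s = None}) =
      (\<integral>\<^sup>+ s. of_nat T * indicator {s. snd s = None} s \<partial>measure_pmf ?p)"
    by (simp add: nn_integral_cmult measure_pmf.emeasure_eq_measure ennreal_mult ennreal_of_nat_eq_real_of_nat)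
  also have "\<dots> \<le> (\<integral>\<^sup>+ s. of_nat (length (fst s)) \<partial>measure_pmf ?p)"
    by (intro nn_integral_mono_AE AE_pmfI) (auto simp: indicator_def dest: length_run)
  also have "\<dots> \<le> expected_queries n E L A"
    unfolding expected_queries_def by (rule SUP_upper) simp
  also have "\<dots> \<le> ennreal Q"
    by fact
  finally show ?thesis
    using assms(2,3) by (simp add: field_simps)
qed

text \<open>An output outside of \<open>X\<close> is never revised.\<close>

lemma prob_run_still_possible_antimono:
  "antimono (\<lambda>k. measure_pmf.prob (run n E L A k) {s. snd s \<in> insert None (Some ` X)})"
proof (rule decseq_SucI)
  fix k
  let ?S = "{s :: transcript \<times> edge option. snd s \<in> insert None (Some ` X)}"
  have "emeasure (step n E L A s) ?S \<le> indicator ?S s" for s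
  proof (cases "s \<in> ?S")
    case True
    then show ?thesis
      by (simp add: measure_pmf.emeasure_le_1)
  next
    case False
    then obtain h e where "s = (h, Some e)" "e \<notin> X"
      by (cases s; cases "snd s") auto
    then show ?thesis
      by (auto simp: indicator_def)
  qed
  then have "emeasure (run n E L A (Suc k)) ?S \<le>
      (\<integral>\<^sup>+ s. indicator ?S s \<partial>measure_pmf (run n E L A k))"
    by (simp only: run.simps emeasure_bind_pmf nn_integral_mono)
  then show "measure_pmf.prob (run n E L A (Suc k)) ?S \<le> measure_pmf.prob (run n E L A k) ?S"
    by (simp add: measure_pmf.emeasure_eq_measure del: run.simps emeasure_bind_pmf)
qed

text \<open>This carries a property of the limit law \<open>D\<close> to a fixed time
  \<open>T\<close>: for \<open>k \<ge> T\<close>, the probability of an output in \<open>X\<close>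
  by time \<open>k\<close> is at most that of the antimonotone event at time \<open>T\<close>; then
  \<open>k\<close> tends to infinity.\<close>

lemma prob_run_still_possible_ge:
  assumes "samples_from n E L A D" "finite X"
  shows "measure_pmf.prob D X \<le>
    measure_pmf.prob (run n E L A T) {s. snd s \<in> insert None (Some ` X)}"
proof -
  let ?S = "{s :: transcript \<times> edge option. snd s \<in> insert None (Some ` X)}"
  have "(\<lambda>k. \<Sum>e\<in>X. measure_pmf.prob (run n E L A k) {s. snd s = Some e}) \<longlonglongrightarrow> (\<Sum>e\<in>X. pmf D e)"
    using assms(1) unfolding samples_from_def by (intro tendsto_sum) blast
  moreover have "(\<Sum>e\<in>X. pmf D e) = measure_pmf.prob D X"
    using assms(2) by (simp add: measure_measure_pmf_finite)
  moreover have "(\<Sum>e\<in>X. measure_pmf.prob (run n E L A k) {s. snd s = Some e}) \<le>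
      measure_pmf.prob (run n E L A T) ?S" if "k \<ge> T" for k
  proof -
    have "(\<Sum>e\<in>X. measure_pmf.prob (run n E L A k) {s. snd s = Some e}) =
        measure_pmf.prob (run n E L A k) (\<Union>e\<in>X. {s. snd s = Some e})"
      using assms(2)
      by (intro measure_pmf.finite_measure_finite_Union[symmetric]) (auto simp: disjoint_family_on_def)
    also have "\<dots> \<le> measure_pmf.prob (run n E L A k) ?S"
      by (intro measure_pmf.finite_measure_mono) auto
    also have "\<dots> \<le> measure_pmf.prob (run n E L A T) ?S"
      using antimonoD[OF prob_run_still_possible_antimono that] .
    finally show ?thesis .
  qed
  ultimately show ?thesis
    by (metis (no_types, lifting) LIMSEQ_le_const2)
qed

section \<open>Closeness to uniform\<close>

lemma tv_close_to_uniform_prob_ge: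
  assumes "tv_close_to_uniform \<epsilon> D X" "finite X" "X \<noteq> {}"
  shows "measure_pmf.prob D X \<ge> 1 - \<epsilon>"
proof -
  \<comment> \<open>A real supremum bounds its members only if they are bounded above.\<close>
  have "\<bar>measure_pmf.prob P S - measure_pmf.prob Q S\<bar> \<le> 1" for P Q :: "'a pmf" and S
    using measure_pmf.prob_le_1[of P S] measure_pmf.prob_le_1[of Q S]
      measure_nonneg[of P S] measure_nonneg[of Q S] by linarith
  then have "\<bar>measure_pmf.prob D X - measure_pmf.prob (pmf_of_set X) X\<bar> \<le> tv_dist D (pmf_of_set X)"
    unfolding tv_dist_def by (intro cSUP_upper bdd_aboveI2[where M = 1]) auto
  moreover have "measure_pmf.prob (pmf_of_set X) X = 1"
    using assms(2,3) by (simp add: measure_pmf_of_set)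
  ultimately show ?thesis
    using assms(1) unfolding tv_close_to_uniform_def by linarith
qed

text \<open>Summing the pointwise lower bounds over \<open>X\<close> suffices. Both notions of
  closeness enter the main argument only through this mass bound.\<close>

lemma pointwise_close_to_uniform_prob_ge:
  assumes "pointwise_close_to_uniform \<epsilon> D X" "finite X" "X \<noteq> {}"
  shows "measure_pmf.prob D X \<ge> 1 - \<epsilon>"
proof -
  have "1 - \<epsilon> = (\<Sum>x\<in>X. (1 - \<epsilon>) * pmf (pmf_of_set X) x)"
    using assms(2,3) by simp
  also have "\<dots> \<le> (\<Sum>x\<in>X. pmf D x)"
    using assms(1) unfolding pointwise_close_to_uniform_def
    by (intro sum_mono) (force simp: algebra_simps)
  also have "\<dots> = measure_pmf.prob D X"
    using assms(2) by (simp add: measure_measure_pmf_finite)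
  finally show ?thesis .
qed

section \<open>The averaging argument\<close>

text \<open>The sum is the expected number of events \<open>X i\<close> that occur.\<close>

lemma sum_prob_le:
  assumes "finite I" "\<And>s. s \<in> set_pmf p \<Longrightarrow> card {i \<in> I. s \<in> X i} \<le> C"
  shows "(\<Sum>i\<in>I. measure_pmf.prob p (X i)) \<le> real C"
proof -
  have int: "integrable (measure_pmf p) (indicat_real (X i))" for i
    by (intro measure_pmf.integrable_const_bound[where B = 1]) auto
  have "(\<Sum>i\<in>I. measure_pmf.prob p (X i)) = (\<integral>s. (\<Sum>i\<in>I. indicat_real (X i) s) \<partial>measure_pmf p)"
    using int by simp
  also have "\<dots> \<le> (\<integral>s. real C \<partial>measure_pmf p)"
  proof (intro integral_mono_AE AE_pmfI)
    fix s assume "s \<in> set_pmf p"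
    have "(\<Sum>i\<in>I. indicat_real (X i) s) = real (card {i \<in> I. s \<in> X i})"
      using assms(1) by (simp add: indicator_def sum.If_cases Int_def)
    then show "(\<Sum>i\<in>I. indicat_real (X i) s) \<le> real C"
      using assms(2)[OF \<open>s \<in> set_pmf p\<close>] by simp
  qed (use int in auto)
  finally show ?thesis
    by simp
qed

text \<open>For each \<open>b\<close>, \<delta> is at most \<open>Q / real T\<close> for a timeout
  plus the probability, on the empty graph, of discovering block \<open>b\<close>. Summing over
  \<open>b\<close> leaves a count of the blocks that one run discovers.\<close>

lemma hidden_graph_lower_bound:
  fixes G :: "nat \<Rightarrow> edge set" and B :: "nat \<Rightarrow> nat set"
  assumes disj: "disjoint_family_on B {..<N}"
    and range: "\<And>b e. b < N \<Longrightarrow> e \<in> G b \<Longrightarrow> e \<subseteq> B b \<and> e \<noteq> {}"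
    and G: "\<And>b. b < N \<Longrightarrow> finite (G b)"
    and samples: "\<And>b. b < N \<Longrightarrow> samples_from n (G b) (L b) A (D b)"
    and close: "\<And>b. b < N \<Longrightarrow> measure_pmf.prob (D b) (G b) \<ge> \<delta>"
    and queries: "\<And>b. b < N \<Longrightarrow> expected_queries n (G b) (L b) A \<le> ennreal Q"
    and T: "0 < T" and Q: "0 \<le> Q"
  shows "real N * \<delta> \<le> real N * (Q / real T) + real T + 1"
proof -
  \<comment> \<open>Block \<open>b\<close> is discovered by a query inside it or by the output of an
    edge of \<open>G b\<close>.\<close>
  define X where "X b = {s :: transcript \<times> edge option.
    queried (fst s) \<inter> B b \<noteq> {} \<or> snd s \<in> Some ` G b}" for b
  define L0 :: "nat \<Rightarrow> nat list" where "L0 = (\<lambda>_. [])"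
  have prob_X: "measure_pmf.prob (run n (G b) (L b) A T) (X b) =
      measure_pmf.prob (run n {} L0 A T) (X b)" if b: "b < N" for b
  proof -
    \<comment> \<open>Point probabilities are compared outside \<open>X b\<close>, where all queried
      vertices are isolated in \<open>G b\<close>; the claim follows by complement.\<close>
    have "pmf (run n (G b) (L b) A T) s = pmf (run n {} L0 A T) s" if "s \<in> - X b" for s
    proof -
      have "neighbors (G b) v = {}" if "v \<in> queried (fst s)" for v
        using \<open>s \<in> - X b\<close> that range[OF b] unfolding X_def neighbors_def by blast
      then show ?thesis
        using pmf_run_isolated[of "fst s" "G b" n "L b" A T "snd s" L0] by simp
    qed
    then have "measure_pmf.prob (run n (G b) (L b) A T) (- X b) =
        measure_pmf.prob (run n {} L0 A T) (- X b)"
      by (auto simp: measure_pmf_conv_infsetsum intro!: infsetsum_cong)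
    then show ?thesis
      using measure_pmf.prob_compl[of "X b" "run n (G b) (L b) A T"]
        measure_pmf.prob_compl[of "X b" "run n {} L0 A T"]
      by (simp add: Compl_eq_Diff_UNIV)
  qed
  have "\<delta> \<le> Q / real T + measure_pmf.prob (run n {} L0 A T) (X b)" if b: "b < N" for b
  proof -
    let ?p = "run n (G b) (L b) A T"
    have "\<delta> \<le> measure_pmf.prob ?p {s. snd s \<in> insert None (Some ` G b)}"
      using close[OF b] prob_run_still_possible_ge[OF samples[OF b] G[OF b]] by (rule order_trans)
    also have "\<dots> \<le> measure_pmf.prob ?p ({s. snd s = None} \<union> X b)"
      by (intro measure_pmf.finite_measure_mono) (auto simp: X_def)
    also have "\<dots> \<le> measure_pmf.prob ?p {s. snd s = None} + measure_pmf.prob ?p (X b)"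
      by (intro measure_subadditive) auto
    also have "\<dots> \<le> Q / real T + measure_pmf.prob (run n {} L0 A T) (X b)"
      using prob_not_output_le[OF queries[OF b] T Q] prob_X[OF b] by simp
    finally show ?thesis .
  qed
  then have "(\<Sum>b<N. \<delta>) \<le> (\<Sum>b<N. Q / real T + measure_pmf.prob (run n {} L0 A T) (X b))"
    by (intro sum_mono) simp
  moreover have "(\<Sum>b<N. measure_pmf.prob (run n {} L0 A T) (X b)) \<le> real (T + 1)"
  proof (intro sum_prob_le)
    fix s assume "s \<in> set_pmf (run n {} L0 A T)"
    then have len: "length (fst s) \<le> T"
      by (simp add: length_run)
    have uniq: "b = b'" if "v \<in> B b" "v \<in> B b'" "b < N" "b' < N" for b b' v
      using disj that by (auto simp: disjoint_family_on_def)
    \<comment> \<open>Blocks are disjoint, so each queried vertex accounts for at most one touched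
      block.\<close>
    define touch where "touch v = (THE b. b < N \<and> v \<in> B b)" for v
    have touch: "touch v = b" if "v \<in> B b" "b < N" for v b
      unfolding touch_def using that uniq by blast
    have "{b \<in> {..<N}. queried (fst s) \<inter> B b \<noteq> {}} \<subseteq> touch ` queried (fst s)"
      using touch by (auto simp: image_iff)
    then have "card {b \<in> {..<N}. queried (fst s) \<inter> B b \<noteq> {}} \<le> card (touch ` queried (fst s))"
      by (intro card_mono) (simp_all add: finite_queried)
    also have "\<dots> \<le> T"
      using card_image_le[OF finite_queried(1), of touch "fst s"] finite_queried(2)[of "fst s"] len
      by linarith
    finally have c1: "card {b \<in> {..<N}. queried (fst s) \<inter> B b \<noteq> {}} \<le> T" .
    \<comment> \<open>Any vertex of the nonempty output edge determines the block; this is the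
      \<open>+ 1\<close> in the count.\<close>
    have "b = b'" if "snd s \<in> Some ` G b" "snd s \<in> Some ` G b'" "b < N" "b' < N" for b b'
      using that range uniq by (metis (no_types, lifting) equals0I imageE option.inject subsetD)
    then have c2: "card {b \<in> {..<N}. snd s \<in> Some ` G b} \<le> 1"
      by (subst One_nat_def, subst card_le_Suc0_iff_eq) auto
    have "{b \<in> {..<N}. s \<in> X b} =
        {b \<in> {..<N}. queried (fst s) \<inter> B b \<noteq> {}} \<union> {b \<in> {..<N}. snd s \<in> Some ` G b}"
      by (auto simp: X_def)
    then show "card {b \<in> {..<N}. s \<in> X b} \<le> T + 1"
      using c1 c2 card_Un_le by (metis (no_types, lifting) add_mono order_trans)
  qed simp
  ultimately show ?thesis
    by (simp add: sum.distrib)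
qed

section \<open>Choice of the blocks and the constants\<close>

theorem theorem1p2:
  fixes \<epsilon> :: real
  assumes "\<epsilon> \<le> 1 / 6"
  shows "\<exists>c>0. \<exists>K::real. \<forall>(n::nat) (m::nat) (\<alpha>::real) (d::real).
    \<alpha> \<le> sqrt (real m) \<longrightarrow> real m \<le> real n * \<alpha> \<longrightarrow> d = 2 * real m / real n \<longrightarrow>
    graph_family n m \<alpha> \<noteq> {} \<longrightarrow> \<alpha> / d \<ge> K \<longrightarrow>
    (\<forall>(L :: edge set \<Rightarrow> nat \<Rightarrow> nat list) (A :: algorithm).
       (\<forall>E\<in>graph_family n m \<alpha>. neighbor_order n E (L E)) \<longrightarrow>
       (\<forall>E\<in>graph_family n m \<alpha>. \<exists>D. samples_from n E (L E) A D \<and> tv_close_to_uniform \<epsilon> D E) \<or>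
       (\<forall>E\<in>graph_family n m \<alpha>. \<exists>D. samples_from n E (L E) A D \<and> pointwise_close_to_uniform \<epsilon> D E) \<longrightarrow>
       (\<exists>E\<in>graph_family n m \<alpha>. expected_queries n E (L E) A \<ge> ennreal (c * (\<alpha> / d))))"
proof (rule exI[of _ "1 / 72"], intro exI[of _ 100] conjI allI impI)
  fix n m :: nat and \<alpha> d :: real and L :: "edge set \<Rightarrow> nat \<Rightarrow> nat list" and A :: algorithm
  assume \<alpha>_le: "\<alpha> \<le> sqrt (real m)" and d: "d = 2 * real m / real n"
    and nonempty: "graph_family n m \<alpha> \<noteq> {}" and K: "100 \<le> \<alpha> / d"
    and close: "(\<forall>E\<in>graph_family n m \<alpha>. \<exists>D. samples_from n E (L E) A D \<and> tv_close_to_uniform \<epsilon> D E) \<or>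
       (\<forall>E\<in>graph_family n m \<alpha>. \<exists>D. samples_from n E (L E) A D \<and> pointwise_close_to_uniform \<epsilon> D E)"
  have "d \<noteq> 0"
    using K by auto
  then have n: "n > 0" and m: "m > 0"
    using d by auto
  have \<alpha>: "\<alpha> \<ge> 1"
  proof -
    obtain E where "simple_graph n E" "card E = m" "real (arboricity E) \<le> \<alpha>"
      using nonempty by (auto simp: graph_family_def)
    moreover from this have "arboricity E \<ge> 1"
      using m card.infinite by (intro arboricity_pos) fastforce+
    ultimately show ?thesis
      by linarith
  qed
  \<comment> \<open>The floor keeps the arboricity of \<open>a\<close> stars below \<alpha>;
    \<open>h\<close> is the block size from \<open>stars_range\<close>, and \<open>N\<close> blocks
    fit into the \<open>n\<close> vertices.\<close>
  define a where "a = nat \<lfloor>\<alpha>\<rfloor>"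
  define h where "h = a + 1 + (m - 1) div a"
  define N where "N = n div h"
  have "1 \<le> \<lfloor>\<alpha>\<rfloor>" "real a = of_int \<lfloor>\<alpha>\<rfloor>"
    using \<alpha> by (simp_all add: a_def)
  then have a: "a > 0" "real a \<le> \<alpha>" "\<alpha> \<le> 2 * real a"
    using \<alpha> by linarith+
  have h0: "h > 0"
    by (simp add: h_def)
  \<comment> \<open>The three terms of \<open>a * h\<close> are each at most \<open>m\<close>, where
    \<open>a \<le> a * a \<le> m\<close> comes from \<alpha> \<le> sqrt m. Rounding \<alpha> down
    costs the factor 2.\<close>
  have h: "real h * \<alpha> \<le> 6 * real m"
  proof -
    have "real a * real a \<le> sqrt (real m) * sqrt (real m)"
      using a \<alpha>_le by (intro mult_mono) auto
    then have aa: "real a * real a \<le> real m"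
      by simp
    have "a * ((m - 1) div a) \<le> m - 1"
      by simp
    then have "real (a * ((m - 1) div a)) \<le> real m"
      using m by linarith
    then have q: "real a * real ((m - 1) div a) \<le> real m"
      by simp
    have "real a * 1 \<le> real a * real a"
      using a(1) by (intro mult_left_mono) auto
    then have "real a * real h \<le> 3 * real m"
      using aa q by (simp add: h_def distrib_left)
    moreover have "real h * \<alpha> \<le> real h * (2 * real a)"
      using a(3) by (intro mult_left_mono) auto
    ultimately show ?thesis
      by (simp add: mult.commute mult.left_commute)
  qed
  have ratio: "\<alpha> / d = \<alpha> * real n / (2 * real m)"
    using d n m by simp
  \<comment> \<open>From \<open>n < (N + 1) * h\<close> follows \<alpha> n \<le> 6 m (N + 1);
    dividing by 2 m gives the factor 3.\<close>
  have N: "\<alpha> / d \<le> 3 * (real N + 1)"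
  proof -
    have "n < (N + 1) * h"
      using h0 unfolding N_def by (simp add: dividend_less_div_times add.commute)
    then have "real n \<le> (real N + 1) * real h"
      by (metis less_imp_le of_nat_1 of_nat_add of_nat_le_iff of_nat_mult)
    then have "\<alpha> * real n \<le> \<alpha> * ((real N + 1) * real h)"
      using \<alpha> by (intro mult_left_mono) auto
    also have "\<dots> = (real N + 1) * (real h * \<alpha>)"
      by simp
    also have "\<dots> \<le> (real N + 1) * (6 * real m)"
      using h by (intro mult_left_mono) auto
    finally show ?thesis
      using m unfolding ratio by (simp add: field_simps)
  qed
  define G where "G b = stars a m (b * h)" for b
  define B where "B b = {b * h + 1..b * h + h}" for b
  have G_family: "G b \<in> graph_family n m \<alpha>" if "b < N" for b
  proof -
    have "(b + 1) * h \<le> N * h"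
      using that by (intro mult_right_mono) auto
    also have "\<dots> \<le> n"
      by (simp add: N_def)
    finally have "simple_graph n (G b)"
      unfolding G_def using a(1) by (intro simple_graph_stars) (simp_all add: h_def add.commute)
    moreover have "real (arboricity (G b)) \<le> \<alpha>"
      using arboricity_stars[OF a(1), of m "b * h"] a(2) unfolding G_def by linarith
    ultimately show ?thesis
      by (simp add: graph_family_def G_def card_stars a(1))
  qed
  have G_finite: "finite (G b)" "G b \<noteq> {}" for b
    using m by (auto simp: G_def stars_def)
  have G_range: "e \<subseteq> B b \<and> e \<noteq> {}" if "e \<in> G b" for b e
    using that stars_range[OF a(1)] unfolding G_def B_def h_def
    by (force simp: stars_def star_edge_def)
  have "disjoint_family_on B {..<N}"
  proof -
    \<comment> \<open>Blocks start at \<open>b * h + 1\<close>, hence the shift by one.\<close>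
    have "(v - 1) div h = b" if v: "v \<in> B b" for v b
    proof -
      have "v - 1 = b * h + (v - 1 - b * h)" "v - 1 - b * h < h"
        using v h0 by (auto simp: B_def)
      then show ?thesis
        by (metis add.right_neutral div_less div_mult_self3 h0 less_not_refl2)
    qed
    then show ?thesis
      unfolding disjoint_family_on_def by blast
  qed
  have "\<exists>D. samples_from n (G b) (L (G b)) A D \<and> measure_pmf.prob D (G b) \<ge> 5 / 6" if b: "b < N" for b
  proof -
    obtain D where "samples_from n (G b) (L (G b)) A D"
      "tv_close_to_uniform \<epsilon> D (G b) \<or> pointwise_close_to_uniform \<epsilon> D (G b)"
      using close G_family[OF b] by blast
    moreover from this have "measure_pmf.prob D (G b) \<ge> 1 - \<epsilon>"
      using tv_close_to_uniform_prob_ge[OF _ G_finite] pointwise_close_to_uniform_prob_ge[OF _ G_finite]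
      by metis
    ultimately show ?thesis
      using assms by force
  qed
  then obtain D where D: "\<And>b. b < N \<Longrightarrow> samples_from n (G b) (L (G b)) A (D b)"
    "\<And>b. b < N \<Longrightarrow> measure_pmf.prob (D b) (G b) \<ge> 5 / 6"
    by metis
  \<comment> \<open>With this constant, \<open>N\<close> is at least \<open>24 * Q - 1\<close>,
    which contradicts the bound \<open>6 * Q + 6\<close> below once \<open>Q \<ge> 1\<close>; the
    threshold 100 ensures the latter.\<close>
  define Q where "Q = 1 / 72 * (\<alpha> / d)"
  define T where "T = nat \<lceil>2 * Q\<rceil>"
  have Q: "Q \<ge> 1"
    using K by (simp add: Q_def)
  have T: "2 * Q \<le> real T" "real T \<le> 2 * Q + 1" "T > 0"
    using Q unfolding T_def by linarith+
  show "\<exists>E\<in>graph_family n m \<alpha>. expected_queries n E (L E) A \<ge> ennreal (1 / 72 * (\<alpha> / d))"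
  proof (rule ccontr)
    assume "\<not> ?thesis"
    then have "expected_queries n (G b) (L (G b)) A \<le> ennreal Q" if "b < N" for b
      using G_family[OF that] unfolding Q_def by (meson linear)
    then have "real N * (5 / 6) \<le> real N * (Q / real T) + real T + 1"
      using \<open>disjoint_family_on B {..<N}\<close> G_range G_finite(1) D T(3) Q
      by (intro hidden_graph_lower_bound[where B = B and G = G and L = "\<lambda>b. L (G b)" and D = D]) auto
    \<comment> \<open>A timeout costs at most 1/2, so 5/6 - 1/2 = 1/3 remains and
      \<open>N / 3\<close> is at most \<open>T + 1\<close>, hence at most
      \<open>2 * Q + 2\<close>.\<close>
    moreover have "real N * (Q / real T) \<le> real N * (1 / 2)"
      using T Q by (intro mult_left_mono) (auto simp: field_simps)
    ultimately have "real N \<le> 6 * Q + 6"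
      using T(2) by linarith
    moreover have "72 * Q \<le> 3 * (real N + 1)"
      using N by (simp add: Q_def)
    ultimately show False
      using Q by simp
  qed
qed simp

end
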